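(* For $k\ge 0$ let $a_{2k}$ be the number of elements $x\in W(B_6)$ with $x^2=1$ (including the identity) and Coxeter length $\ell(x)=2k$. Then the sequence $(a_0,a_2,a_4,\dots,a_{36})$ is $$[1,10,20,27,35,41,49,51,55,54,55,51,49,41,35,27,20,10,1].$$ In particular this sequence is not unimodal, so it is not true that for every $n$ the even involution length profile of $W(B_n)$ is unimodal.
   Context: $W(B_n)$ is the group of signed permutations of $\{1,\dots,n\}$: bijections $w$ of $\{\pm1,\dots,\pm n\}$ with $w(-i)=-w(i)$, acting on $\mathbb{R}^n$ with orthonormal basis $e_1,\dots,e_n$ by $w\cdot e_i=e_{w(i)}$, where $e_{-i}=-e_i$. The positive roots are $e_j\pm e_i$ ($1\le i<j\le n$) and $e_i$ ($1\le i\le n$); the fundamental reflections are those in the simple roots $e_1$ and $e_{i+1}-e_i$ ($1\le i<n$). The length $\ell(w)$ is the least number of fundamental reflections in an expression for $w$; equivalently the number of positive roots sent to negative roots by $w$. The even involution length profile of $W(B_n)$ is the sequence whose $k$-th entry is the number of $x\in W(B_n)$ with $x^2=1$ and $\ell(x)=2k$, $k=0,1,2,\dots$, up to the last nonzero entry. A sequence $(x_i)_{i=1}^N$ of non-negative integers is unimodal if for some $j$, $x_1\le\cdots\le x_{j-1}\le x_j\ge x_{j+1}\ge\cdots\ge x_N$. *)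

theory Defs
  imports Complex_Main "HOL-Combinatorics.Permutations"
begin

text \<open>
  Following the convention of \<^const>\<open>permutes\<close>, a signed permutation of \<open>{1..n}\<close> is a function on
  all of \<^typ>\<open>int\<close> that is the identity off \<open>{\<plusminus>1, ..., \<plusminus>n}\<close>. The product in \<open>W(B\<^sub>n)\<close> is
  \<^term>\<open>(\<circ>)\<close> and its unit is \<^term>\<open>id\<close>.
\<close>

definition signed_perms :: "nat \<Rightarrow> (int \<Rightarrow> int) set" where
  "signed_perms n =
     {w. w permutes ({- int n..int n} - {0}) \<and> (\<forall>i. w (- i) = - w i)}"

text \<open>
  As \<open>n\<close> varies, \<open>\<real>\<^sup>n\<close> is the space of functions \<^typ>\<open>int \<Rightarrow> real\<close> supported on \<open>{1..n}\<close>.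
  The index of a basis vector may be negative: \<open>e\<^bsub>-i\<^esub> = - e\<^bsub>i\<^esub>\<close>.
\<close>

definition vecs :: "nat \<Rightarrow> (int \<Rightarrow> real) set" where
  "vecs n = {v. \<forall>j. j \<notin> {1..int n} \<longrightarrow> v j = 0}"

definition basis_vec :: "int \<Rightarrow> int \<Rightarrow> real" where
  "basis_vec i = (\<lambda>j. if j = \<bar>i\<bar> then of_int (sgn i) else 0)"

definition inner_prod :: "nat \<Rightarrow> (int \<Rightarrow> real) \<Rightarrow> (int \<Rightarrow> real) \<Rightarrow> real" where
  "inner_prod n u v = (\<Sum>j = 1..int n. u j * v j)"

definition act :: "nat \<Rightarrow> (int \<Rightarrow> int) \<Rightarrow> (int \<Rightarrow> real) \<Rightarrow> (int \<Rightarrow> real)" where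
  "act n w v = (\<lambda>j. \<Sum>i = 1..int n. v i * basis_vec (w i) j)"

definition reflection :: "nat \<Rightarrow> (int \<Rightarrow> real) \<Rightarrow> (int \<Rightarrow> real) \<Rightarrow> (int \<Rightarrow> real)" where
  "reflection n r v = (\<lambda>j. v j - 2 * inner_prod n v r / inner_prod n r r * r j)"

definition simple_roots :: "nat \<Rightarrow> (int \<Rightarrow> real) set" where
  "simple_roots n =
     {r. (1 \<le> n \<and> r = basis_vec 1) \<or>
         (\<exists>i. 1 \<le> i \<and> i < int n \<and> r = (\<lambda>j. basis_vec (i + 1) j - basis_vec i j))}"

definition fundamental_reflections :: "nat \<Rightarrow> (int \<Rightarrow> int) set" where
  "fundamental_reflections n =
     {s \<in> signed_perms n. \<exists>r \<in> simple_roots n. \<forall>v \<in> vecs n. act n s v = reflection n r v}"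

definition coxeter_length :: "nat \<Rightarrow> (int \<Rightarrow> int) \<Rightarrow> nat" where
  "coxeter_length n w =
     (LEAST k. \<exists>ss. length ss = k \<and> set ss \<subseteq> fundamental_reflections n \<and> foldr (\<circ>) ss id = w)"

text \<open>As in the informal convention, the identity counts as an involution.\<close>

definition involution_count :: "nat \<Rightarrow> nat \<Rightarrow> nat" where
  "involution_count n l =
     card {x \<in> signed_perms n. x \<circ> x = id \<and> coxeter_length n x = l}"

definition even_involution_profile :: "nat \<Rightarrow> nat list" where
  "even_involution_profile n =
     map (\<lambda>k. involution_count n (2 * k)) [0..<Suc (Max {k. involution_count n (2 * k) \<noteq> 0})]"

definition unimodal :: "nat list \<Rightarrow> bool" where
  "unimodal xs \<longleftrightarrow>
     (\<exists>j < length xs.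
        (\<forall>i. i < j \<longrightarrow> xs ! i \<le> xs ! Suc i) \<and>
        (\<forall>i. j \<le> i \<and> Suc i < length xs \<longrightarrow> xs ! Suc i \<le> xs ! i))"

end

theory Submission
  imports Defs "HOL-Computational_Algebra.Polynomial"
begin

text \<open>
  Multiplying on the right by a fundamental reflection changes the number of positive roots made
  negative by exactly one, and only the identity has no descent, so this number is the Coxeter
  length. Now let \<open>w\<close> be an involution with \<open>w n = e\<close>. Deleting \<open>n\<close> and \<open>\<bar>e\<bar>\<close> leaves a smaller involution
  and lowers the length by an amount depending only on \<open>e\<close>: it is \<open>0\<close> for \<open>e = n\<close>, \<open>2n - 1\<close> for
  \<open>e = -n\<close>, \<open>2(n - m) - 1\<close> for \<open>e = m < n\<close> and \<open>2(n + m) - 3\<close> for \<open>e = -m\<close>. The last two run through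
  the odd numbers below \<open>4(n - 1)\<close>, so the length generating function satisfies
  \<open>F n = (1 + q\<^sup>2\<^sup>n\<^sup>-\<^sup>1) F (n - 1) + (q + q\<^sup>3 + \<dots> + q\<^sup>4\<^sup>n\<^sup>-\<^sup>5) F (n - 2)\<close>, and \<open>F 6\<close> is computed from this.
  The sequence fails to be unimodal at \<open>55, 54, 55\<close>.

  Deletion is carried out without relabelling: involutions are taken on an arbitrary finite set of
  positive integers, and their generating function depends only on its cardinality.
\<close>

section \<open>The inversion statistic\<close>

text \<open>If \<open>e_i\<close>, \<open>e_j\<close> with \<open>i < j\<close> go to
  \<open>e_x\<close>, \<open>e_y\<close>, the root \<open>e_j - e_i\<close> becomes negative iff
  \<open>y < x\<close>, and \<open>e_j + e_i\<close> iff \<open>x + y < 0\<close>.\<close>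

definition pair_inv :: "int \<Rightarrow> int \<Rightarrow> nat" where
  "pair_inv x y = of_bool (y < x) + of_bool (x + y < 0)"

definition ordered_pairs :: "int set \<Rightarrow> (int \<times> int) set" where
  "ordered_pairs A = {(i, j). i \<in> A \<and> j \<in> A \<and> i < j}"

text \<open>The number of positive roots with indices in \<open>A\<close> made negative: first the
  roots \<open>e_i\<close>, then the roots \<open>e_j \<plusminus> e_i\<close>.\<close>

definition signed_inv :: "int set \<Rightarrow> (int \<Rightarrow> int) \<Rightarrow> nat" where
  "signed_inv A w =
     (\<Sum>i\<in>A. of_bool (w i < 0)) + (\<Sum>(i, j)\<in>ordered_pairs A. pair_inv (w i) (w j))"

lemma finite_ordered_pairs: "finite A \<Longrightarrow> finite (ordered_pairs A)"
  by (rule finite_subset[of _ "A \<times> A"]) (auto simp: ordered_pairs_def)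

lemma signed_inv_cong:
  assumes "\<And>i. i \<in> A \<Longrightarrow> w i = w' i"
  shows "signed_inv A w = signed_inv A w'"
  using assms unfolding signed_inv_def ordered_pairs_def
  by (intro arg_cong2[where f = "(+)"] sum.cong) auto

text \<open>The only new pairs are those containing \<open>x\<close>. Since \<open>x\<close> may lie
  anywhere relative to \<open>A\<close>, each must be listed in increasing order.\<close>

lemma signed_inv_insert:
  assumes "finite A" "x \<notin> A"
  shows "signed_inv (insert x A) w = signed_inv A w + of_bool (w x < 0) +
    (\<Sum>c\<in>A. if c < x then pair_inv (w c) (w x) else pair_inv (w x) (w c))"
proof -
  let ?h = "\<lambda>c. if c < x then (c, x) else (x, c)"
  have eq: "ordered_pairs (insert x A) = ordered_pairs A \<union> ?h ` A"
    using assms(2) by (auto simp: ordered_pairs_def image_iff split: if_splits)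
      (metis linorder_neqE)+
  have disj: "ordered_pairs A \<inter> ?h ` A = {}"
    using assms(2) by (auto simp: ordered_pairs_def)
  have inj: "inj_on ?h A"
    using assms(2) by (auto simp: inj_on_def split: if_splits)
  have "(\<Sum>(i, j)\<in>ordered_pairs (insert x A). pair_inv (w i) (w j)) =
    (\<Sum>(i, j)\<in>ordered_pairs A. pair_inv (w i) (w j)) +
    (\<Sum>(i, j)\<in>?h ` A. pair_inv (w i) (w j))"
    unfolding eq using assms(1) disj
    by (intro sum.union_disjoint) (auto simp: finite_ordered_pairs)
  also have "(\<Sum>(i, j)\<in>?h ` A. pair_inv (w i) (w j)) =
    (\<Sum>c\<in>A. if c < x then pair_inv (w c) (w x) else pair_inv (w x) (w c))"
    by (subst sum.reindex[OF inj]) (auto intro!: sum.cong)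
  finally show ?thesis
    using assms by (simp add: signed_inv_def)
qed

section \<open>Coxeter length\<close>

definition sign_change :: "int \<Rightarrow> int" where
  "sign_change i = (if \<bar>i\<bar> = 1 then - i else i)"

definition adj_swap :: "int \<Rightarrow> int \<Rightarrow> int" where
  "adj_swap k i =
     (if i = k then k + 1 else if i = k + 1 then k
      else if i = - k then - (k + 1) else if i = - (k + 1) then - k else i)"

lemma signed_permsD:
  assumes "w \<in> signed_perms n"
  shows "w (- i) = - w i" "w i = w j \<longleftrightarrow> i = j" "i \<notin> {- int n..int n} \<Longrightarrow> w i = i" "w 0 = 0"
    "\<bar>i\<bar> \<in> {1..int n} \<Longrightarrow> \<bar>w i\<bar> \<in> {1..int n}"
proof -
  have p: "w permutes ({- int n..int n} - {0})" and odd: "\<And>i. w (- i) = - w i"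
    using assms by (auto simp: signed_perms_def)
  show "w (- i) = - w i" by (rule odd)
  show "w i = w j \<longleftrightarrow> i = j" using permutes_inj[OF p] by (auto simp: inj_def)
  show "i \<notin> {- int n..int n} \<Longrightarrow> w i = i" using permutes_not_in[OF p] by auto
  show "w 0 = 0" using permutes_not_in[OF p] by auto
  show "\<bar>w i\<bar> \<in> {1..int n}" if "\<bar>i\<bar> \<in> {1..int n}"
    using permutes_in_image[OF p, of i] that by auto
qed

lemma signed_perms_comp:
  "v \<in> signed_perms n \<Longrightarrow> w \<in> signed_perms n \<Longrightarrow> v \<circ> w \<in> signed_perms n"
  by (auto simp: signed_perms_def intro: permutes_compose)

lemma signed_perms_id: "id \<in> signed_perms n"
  by (auto simp: signed_perms_def permutes_id)

lemma signed_perms_eqI: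
  assumes "v \<in> signed_perms n" "w \<in> signed_perms n" "\<And>i. i \<in> {1..int n} \<Longrightarrow> v i = w i"
  shows "v = w"
proof
  fix i
  consider "i \<in> {1..int n}" | "- i \<in> {1..int n}" | "i = 0" | "i \<notin> {- int n..int n}" by force
  then show "v i = w i"
    using assms(3)[of i] assms(3)[of "- i"] signed_permsD[OF assms(1)] signed_permsD[OF assms(2)]
    by cases auto
qed

lemma involution_permutes:
  assumes "\<And>i. w (w i) = i" "\<And>i. i \<notin> S \<Longrightarrow> w i = i"
  shows "w permutes S"
  using assms unfolding permutes_def by metis

lemma sign_change_involution [simp]: "sign_change (sign_change i) = i"
  by (auto simp: sign_change_def)

lemma adj_swap_involution:
  assumes "1 \<le> k"
  shows "adj_swap k (adj_swap k i) = i"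
  using assms by (simp add: adj_swap_def)

lemma sign_change_signed_perms: "1 \<le> n \<Longrightarrow> sign_change \<in> signed_perms n"
  by (auto simp: signed_perms_def sign_change_def intro!: involution_permutes split: if_splits)

lemma adj_swap_signed_perms:
  assumes "1 \<le> k" "k < int n"
  shows "adj_swap k \<in> signed_perms n"
  unfolding signed_perms_def
proof (intro CollectI conjI allI involution_permutes)
  show "adj_swap k (adj_swap k i) = i" for i by (rule adj_swap_involution[OF assms(1)])
  show "adj_swap k i = i" if "i \<notin> {- int n..int n} - {0}" for i
    using that assms by (auto simp: adj_swap_def)
  show "adj_swap k (- i) = - adj_swap k i" for i
    using assms(1) by (simp add: adj_swap_def)
qed

section \<open>The linear action\<close>

lemma basis_vec_inj:
  assumes "basis_vec a = basis_vec b" "a \<noteq> 0"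
  shows "a = b"
proof -
  have "basis_vec a \<bar>a\<bar> = basis_vec b \<bar>a\<bar>" using assms(1) by simp
  then have "\<bar>a\<bar> = \<bar>b\<bar> \<and> sgn a = sgn b"
    using assms(2) by (auto simp: basis_vec_def sgn_0_0 split: if_splits)
  then show ?thesis by (metis mult_sgn_abs)
qed

lemma basis_vec_pos: "1 \<le> i \<Longrightarrow> basis_vec i j = of_bool (j = i)"
  by (auto simp: basis_vec_def)

lemma act_basis_vec:
  assumes "i \<in> {1..int n}"
  shows "act n w (basis_vec i) = basis_vec (w i)"
proof
  fix j
  have "act n w (basis_vec i) j = (\<Sum>k = 1..int n. if k = i then basis_vec (w i) j else 0)"
    unfolding act_def using assms by (intro sum.cong) (auto simp: basis_vec_pos)
  then show "act n w (basis_vec i) j = basis_vec (w i) j"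
    using assms by simp
qed

text \<open>Basis vectors reveal the images \<open>v i\<close>. Fundamental reflections are defined
  through their action, so this is what pins them down as permutations.\<close>

lemma act_faithful:
  assumes "v \<in> signed_perms n" "w \<in> signed_perms n" "\<And>x. x \<in> vecs n \<Longrightarrow> act n v x = act n w x"
  shows "v = w"
proof (rule signed_perms_eqI[OF assms(1,2)])
  fix i assume i: "i \<in> {1..int n}"
  then have "basis_vec i \<in> vecs n" by (auto simp: vecs_def basis_vec_def)
  from assms(3)[OF this] have "basis_vec (v i) = basis_vec (w i)"
    by (simp only: act_basis_vec[OF i])
  then show "v i = w i"
    using basis_vec_inj signed_permsD(5)[OF assms(1), of i] i by force
qed

text \<open>In general coordinate \<open>j\<close> of the image is read off through the inverse of
  \<open>w\<close>; for an involution the inverse is \<open>w\<close> itself.\<close>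

lemma act_involution:
  assumes "w \<in> signed_perms n" "\<And>i. w (w i) = i" "j \<in> {1..int n}"
  shows "act n w v j = v \<bar>w j\<bar> * of_int (sgn (w j))"
proof -
  note D = signed_permsD[OF assms(1)]
  have abs: "w \<bar>i\<bar> = sgn i * w i" for i
    using D(1,4) by (auto simp: abs_if sgn_if)
  \<comment> \<open>Hence a single summand contributes to coordinate \<open>j\<close>.\<close>
  have iff: "j = \<bar>w i\<bar> \<longleftrightarrow> i = \<bar>w j\<bar>" if "i \<in> {1..int n}" for i
  proof
    assume "j = \<bar>w i\<bar>"
    then have "w j = sgn (w i) * i" by (simp add: abs assms(2))
    then show "i = \<bar>w j\<bar>" using that D(5)[of i] by (auto simp: abs_mult sgn_if)
  next
    assume "i = \<bar>w j\<bar>"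
    then have "w i = sgn (w j) * j" by (simp add: abs assms(2))
    then show "j = \<bar>w i\<bar>" using assms(3) D(5)[of j] by (auto simp: abs_mult sgn_if)
  qed
  have sgn: "sgn (w \<bar>w j\<bar>) = sgn (w j)"
    using assms(3) by (simp add: abs assms(2) sgn_mult)
  have "act n w v j =
    (\<Sum>i = 1..int n. if i = \<bar>w j\<bar> then v \<bar>w j\<bar> * of_int (sgn (w j)) else 0)"
    unfolding act_def
  proof (intro sum.cong refl)
    fix i assume "i \<in> {1..int n}"
    then show "v i * basis_vec (w i) j =
        (if i = \<bar>w j\<bar> then v \<bar>w j\<bar> * of_int (sgn (w j)) else 0)"
      using iff[of i] sgn unfolding basis_vec_def by (cases "i = \<bar>w j\<bar>") auto
  qed
  then show ?thesis using D(5)[of j] assms(3) by simp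
qed

lemma act_outside:
  assumes "w \<in> signed_perms n" "j \<notin> {1..int n}"
  shows "act n w v j = 0"
  unfolding act_def
proof (intro sum.neutral ballI)
  fix i assume "i \<in> {1..int n}"
  then have "\<bar>w i\<bar> \<in> {1..int n}" using signed_permsD(5)[OF assms(1), of i] by simp
  then show "v i * basis_vec (w i) j = 0" using assms(2) by (auto simp: basis_vec_def)
qed

section \<open>Reflections in simple roots\<close>

lemma inner_prod_basis_vec:
  assumes "k \<in> {1..int n}"
  shows "inner_prod n v (basis_vec k) = v k"
proof -
  have "inner_prod n v (basis_vec k) = (\<Sum>j = 1..int n. if j = k then v k else 0)"
    unfolding inner_prod_def using assms by (intro sum.cong) (auto simp: basis_vec_pos)
  then show ?thesis using assms by simp
qed

lemma inner_prod_diff: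
  "inner_prod n v (\<lambda>j. x j - y j) = inner_prod n v x - inner_prod n v y"
  by (simp add: inner_prod_def algebra_simps sum_subtractf)

lemma reflection_sign_change:
  assumes "1 \<le> n" "v \<in> vecs n"
  shows "reflection n (basis_vec 1) v = act n sign_change v"
proof
  fix j
  have "reflection n (basis_vec 1) v j = v j - 2 * v 1 * of_bool (j = 1)"
    using assms(1) by (simp add: reflection_def inner_prod_basis_vec) (simp add: basis_vec_pos)
  also have "\<dots> = act n sign_change v j"
  proof (cases "j \<in> {1..int n}")
    case True
    show ?thesis
      by (subst act_involution[OF sign_change_signed_perms[OF assms(1)] _ True])
        (use True in \<open>auto simp: sign_change_def\<close>)
  next
    \<comment> \<open>Off \<open>{1..int n}\<close> both sides vanish, since \<open>v\<close> is
      supported there.\<close>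
    case False
    then show ?thesis
      using assms act_outside[OF sign_change_signed_perms[OF assms(1)] False]
      by (auto simp: vecs_def)
  qed
  finally show "reflection n (basis_vec 1) v j = act n sign_change v j" .
qed

lemma reflection_adj_swap:
  assumes "1 \<le> k" "k < int n" "v \<in> vecs n"
  shows "reflection n (\<lambda>j. basis_vec (k + 1) j - basis_vec k j) v = act n (adj_swap k) v"
proof
  fix j
  note sp = adj_swap_signed_perms[OF assms(1,2)]
  have "reflection n (\<lambda>j. basis_vec (k + 1) j - basis_vec k j) v j =
    v j - (v (k + 1) - v k) * (of_bool (j = k + 1) - of_bool (j = k))"
    using assms(1,2)
    by (simp add: reflection_def inner_prod_diff inner_prod_basis_vec)
      (simp add: basis_vec_pos)
  also have "\<dots> = act n (adj_swap k) v j"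
  proof (cases "j \<in> {1..int n}")
    case True
    show ?thesis
      by (subst act_involution[OF sp adj_swap_involution[OF assms(1)] True])
        (use True assms(1) in \<open>auto simp: adj_swap_def\<close>)
  next
    case False
    then show ?thesis
      using assms act_outside[OF sp False] by (auto simp: vecs_def)
  qed
  finally show "reflection n (\<lambda>j. basis_vec (k + 1) j - basis_vec k j) v j =
    act n (adj_swap k) v j" .
qed

text \<open>Each simple reflection is realised by the explicit generator, and by faithfulness of the
  action by no other signed permutation.\<close>

lemma fundamental_reflections_eq:
  "fundamental_reflections n =
     {s. 1 \<le> n \<and> s = sign_change \<or> (\<exists>k. 1 \<le> k \<and> k < int n \<and> s = adj_swap k)}"
proof (intro set_eqI iffI)
  fix s assume "s \<in> fundamental_reflections n"
  then obtain r where s: "s \<in> signed_perms n" and r: "r \<in> simple_roots n"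
    and act: "\<And>v. v \<in> vecs n \<Longrightarrow> act n s v = reflection n r v"
    by (auto simp: fundamental_reflections_def)
  from r consider "1 \<le> n" "r = basis_vec 1"
    | k where "1 \<le> k" "k < int n" "r = (\<lambda>j. basis_vec (k + 1) j - basis_vec k j)"
    by (auto simp: simple_roots_def)
  then show "s \<in> {s. 1 \<le> n \<and> s = sign_change \<or> (\<exists>k. 1 \<le> k \<and> k < int n \<and> s = adj_swap k)}"
  proof cases
    case 1
    then have "s = sign_change"
      by (intro act_faithful[OF s sign_change_signed_perms])
        (auto simp: act reflection_sign_change)
    then show ?thesis using 1 by simp
  next
    case 2
    then have "s = adj_swap k"
      by (intro act_faithful[OF s adj_swap_signed_perms]) (auto simp: act reflection_adj_swap)
    then show ?thesis using 2 by auto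
  qed
next
  fix s assume "s \<in> {s. 1 \<le> n \<and> s = sign_change \<or> (\<exists>k. 1 \<le> k \<and> k < int n \<and> s = adj_swap k)}"
  then consider "1 \<le> n" "s = sign_change" | k where "1 \<le> k" "k < int n" "s = adj_swap k"
    by blast
  then show "s \<in> fundamental_reflections n"
  proof cases
    case 1
    then have "basis_vec 1 \<in> simple_roots n" by (simp add: simple_roots_def)
    then show ?thesis
      using 1 sign_change_signed_perms reflection_sign_change[OF 1(1)]
      unfolding fundamental_reflections_def by (auto intro!: bexI)
  next
    case 2
    then have "(\<lambda>j. basis_vec (k + 1) j - basis_vec k j) \<in> simple_roots n"
      unfolding simple_roots_def by blast
    then show ?thesis
      using 2 adj_swap_signed_perms reflection_adj_swap
      unfolding fundamental_reflections_def by (auto intro!: bexI)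
  qed
qed

section \<open>Effect of a generator on the number of inversions\<close>

text \<open>Only \<open>w 1\<close> is negated. In pairs starting at 1 this exchanges the two
  conditions of \<open>pair_inv\<close>, so only the root \<open>e_1\<close> changes status. Writing
  the change as terms on both sides avoids subtraction on naturals.\<close>

lemma signed_inv_sign_change:
  assumes "w \<in> signed_perms n" "1 \<le> n"
  shows "signed_inv {1..int n} (w \<circ> sign_change) + of_bool (w 1 < 0) =
    signed_inv {1..int n} w + of_bool (w 1 > 0)"
proof -
  note D = signed_permsD[OF assms(1)]
  let ?P = "ordered_pairs {1..int n}" and ?v = "w \<circ> sign_change"
  have "pair_inv (- x) y = pair_inv x y" for x y
    by (auto simp: pair_inv_def)
  then have pairs: "(\<Sum>(i, j)\<in>?P. pair_inv (?v i) (?v j)) = (\<Sum>(i, j)\<in>?P. pair_inv (w i) (w j))"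
    by (intro sum.cong) (auto simp: ordered_pairs_def sign_change_def D(1))
  have split: "(\<Sum>i\<in>{1..int n}. of_bool (u i < 0)) =
      of_bool (u 1 < 0) + (\<Sum>i\<in>{1..int n} - {1}. of_bool (u i < 0) :: nat)" for u :: "int \<Rightarrow> int"
    using assms(2) by (intro sum.remove) auto
  have "(\<Sum>i\<in>{1..int n} - {1}. of_bool (?v i < 0) :: nat) =
      (\<Sum>i\<in>{1..int n} - {1}. of_bool (w i < 0))"
    by (intro sum.cong) (auto simp: sign_change_def)
  moreover have "?v 1 = - w 1" by (simp add: sign_change_def D(1))
  ultimately show ?thesis
    unfolding signed_inv_def pairs split by simp
qed

text \<open>The swap permutes the ordered pairs other than \<open>(k, k + 1)\<close>, the only one
  whose order it reverses. In that pair the condition \<open>x + y < 0\<close> is symmetric, so only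
  the comparison of the two values changes.\<close>

lemma signed_inv_adj_swap:
  assumes "1 \<le> k" "k < int n"
  shows "signed_inv {1..int n} (w \<circ> adj_swap k) + of_bool (w (k + 1) < w k) =
    signed_inv {1..int n} w + of_bool (w k < w (k + 1))"
proof -
  let ?P = "ordered_pairs {1..int n}" and ?s = "adj_swap k"
  let ?Q = "?P - {(k, k + 1)}"
  have s: "?s i = (if i = k then k + 1 else if i = k + 1 then k else i)" if "i \<ge> 1" for i
    using that assms by (auto simp: adj_swap_def)
  have mem: "map_prod ?s ?s p \<in> ?Q" if "p \<in> ?Q" for p
  proof -
    obtain i j where p: "p = (i, j)" by fastforce
    then have "1 \<le> i" "i < j" "j \<le> int n" "\<not> (i = k \<and> j = k + 1)"
      using that by (auto simp: ordered_pairs_def)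
    then show ?thesis
      using assms by (auto simp: ordered_pairs_def p s)
  qed
  have invol: "map_prod ?s ?s (map_prod ?s ?s p) = p" for p
    using adj_swap_involution[OF assms(1)] by (cases p) simp
  have singles: "(\<Sum>i\<in>{1..int n}. of_bool ((w \<circ> ?s) i < 0) :: nat) =
      (\<Sum>i\<in>{1..int n}. of_bool (w i < 0))"
  proof (rule sum.reindex_bij_witness[of _ ?s ?s])
    fix i assume i: "i \<in> {1..int n}"
    show "?s (?s i) = i" by (rule adj_swap_involution[OF assms(1)])
    then show "?s (?s i) = i" .
    show "?s i \<in> {1..int n}" using i assms by (simp add: s)
    then show "?s i \<in> {1..int n}" .
  qed simp
  have rest: "(\<Sum>(i, j)\<in>?Q. pair_inv ((w \<circ> ?s) i) ((w \<circ> ?s) j)) =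
      (\<Sum>(i, j)\<in>?Q. pair_inv (w i) (w j))"
  proof (rule sum.reindex_bij_witness[of _ "map_prod ?s ?s" "map_prod ?s ?s"])
    fix p assume "p \<in> ?Q"
    then show "map_prod ?s ?s p \<in> ?Q" "map_prod ?s ?s p \<in> ?Q" by (rule mem)+
    show "(case map_prod ?s ?s p of (i, j) \<Rightarrow> pair_inv (w i) (w j)) =
        (case p of (i, j) \<Rightarrow> pair_inv ((w \<circ> ?s) i) ((w \<circ> ?s) j))"
      by (cases p) simp
  qed (rule invol)+
  have split: "(\<Sum>(i, j)\<in>?P. pair_inv (u i) (u j)) =
      pair_inv (u k) (u (k + 1)) + (\<Sum>(i, j)\<in>?Q. pair_inv (u i) (u j))" for u
    using assms by (subst sum.remove[of ?P "(k, k + 1)"])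
      (auto simp: finite_ordered_pairs, auto simp: ordered_pairs_def)
  have "pair_inv ((w \<circ> ?s) k) ((w \<circ> ?s) (k + 1)) + of_bool (w (k + 1) < w k) =
      pair_inv (w k) (w (k + 1)) + of_bool (w k < w (k + 1))"
    using assms(1) by (auto simp: s pair_inv_def)
  then show ?thesis
    unfolding signed_inv_def singles split[of "w \<circ> ?s"] split[of w] rest by linarith
qed

section \<open>Descents and reduced words\<close>

lemma signed_inv_id: "signed_inv {1..int n} id = 0"
  by (auto simp: signed_inv_def ordered_pairs_def pair_inv_def intro!: sum.neutral)

text \<open>The values at \<open>1, ..., n\<close> are then positive, strictly increasing and at
  most \<open>n\<close>. Going up from 1 gives \<open>i \<le> w i\<close>, going down from
  \<open>n\<close> gives \<open>w i \<le> i\<close>.\<close>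

lemma no_descent_imp_id:
  assumes w: "w \<in> signed_perms n" and first: "1 \<le> n \<Longrightarrow> 0 < w 1"
    and mono: "\<And>k. 1 \<le> k \<Longrightarrow> k < int n \<Longrightarrow> w k < w (k + 1)"
  shows "w = id"
proof (rule signed_perms_eqI[OF w signed_perms_id])
  fix i assume i: "i \<in> {1..int n}"
  have lower: "i \<le> w i" if "1 \<le> i" "i \<le> int n" for i
    using that
  proof (induction i rule: int_ge_induct)
    case base then show ?case using first by simp
  next
    case (step i) then show ?case using mono[of i] by simp
  qed
  have upper: "w i \<le> i" if "i \<le> int n" "1 \<le> i" for i
    using that
  proof (induction i rule: int_le_induct)
    case base
    then show ?case using signed_permsD(5)[OF w, of "int n"] by auto
  next
    case (step i)
    then show ?case using mono[of "i - 1"] by simp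
  qed
  show "w i = id i" using lower[of i] upper[of i] i by simp
qed

lemma fundamental_reflections_signed_perms: "fundamental_reflections n \<subseteq> signed_perms n"
  by (auto simp: fundamental_reflections_def)

lemma foldr_comp_snoc: "foldr (\<circ>) (ss @ [s]) id = foldr (\<circ>) ss id \<circ> s"
  by (induction ss) (auto simp: comp_assoc)

lemma foldr_signed_perms:
  "set ss \<subseteq> fundamental_reflections n \<Longrightarrow> foldr (\<circ>) ss id \<in> signed_perms n"
proof (induction ss)
  case Nil
  show ?case using signed_perms_id by (simp add: id_def)
next
  case (Cons s ss)
  have "s \<in> signed_perms n" using Cons.prems fundamental_reflections_signed_perms by auto
  moreover have "foldr (\<circ>) ss id \<in> signed_perms n"
    by (rule Cons.IH) (use Cons.prems in simp)
  moreover have "foldr (\<circ>) (s # ss) id = s \<circ> foldr (\<circ>) ss id" by simp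
  ultimately show ?case by (simp only: signed_perms_comp)
qed

lemma signed_inv_fundamental_le:
  assumes "w \<in> signed_perms n" "s \<in> fundamental_reflections n"
  shows "signed_inv {1..int n} (w \<circ> s) \<le> Suc (signed_inv {1..int n} w)"
proof -
  from assms(2) consider "1 \<le> n" "s = sign_change" | k where "1 \<le> k" "k < int n" "s = adj_swap k"
    by (auto simp: fundamental_reflections_eq)
  then show ?thesis
  proof cases
    case 1
    then show ?thesis using signed_inv_sign_change[OF assms(1) 1(1)] by (simp add: of_bool_def split: if_splits)
  next
    case 2
    then show ?thesis using signed_inv_adj_swap[OF 2(1,2), of w] by (simp add: of_bool_def split: if_splits)
  qed
qed

text \<open>The lower bound on Coxeter length: the empty word has no inversions, and each letter
  appended on the right adds at most one.\<close>

lemma signed_inv_foldr_le: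
  "set ss \<subseteq> fundamental_reflections n \<Longrightarrow> signed_inv {1..int n} (foldr (\<circ>) ss id) \<le> length ss"
proof (induction ss rule: rev_induct)
  case Nil
  then show ?case using signed_inv_id by (simp add: id_def)
next
  case (snoc s ss)
  then have "signed_inv {1..int n} (foldr (\<circ>) ss id \<circ> s) \<le>
      Suc (signed_inv {1..int n} (foldr (\<circ>) ss id))"
    by (intro signed_inv_fundamental_le foldr_signed_perms) auto
  also have "signed_inv {1..int n} (foldr (\<circ>) ss id) \<le> length ss"
    by (rule snoc.IH) (use snoc.prems in simp)
  finally show ?case unfolding foldr_comp_snoc by (simp only: length_append_singleton)
qed

text \<open>Otherwise \<open>no_descent_imp_id\<close> would apply. The weak inequalities its
  negation provides are strict because \<open>w 1\<close> is nonzero and \<open>w\<close> is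
  injective.\<close>

lemma exists_descent:
  assumes w: "w \<in> signed_perms n" and "w \<noteq> id"
  obtains s where "s \<in> fundamental_reflections n"
    "Suc (signed_inv {1..int n} (w \<circ> s)) = signed_inv {1..int n} w"
proof -
  note D = signed_permsD[OF w]
  consider "1 \<le> n" "w 1 \<le> 0" | k where "1 \<le> k" "k < int n" "w (k + 1) \<le> w k"
    using no_descent_imp_id[OF w] \<open>w \<noteq> id\<close> by (force simp: not_less)
  then show thesis
  proof cases
    case 1
    then have "w 1 < 0" using D(5)[of 1] by auto
    then show thesis
      using signed_inv_sign_change[OF w 1(1)] 1
      by (intro that[of sign_change]) (simp_all add: fundamental_reflections_eq)
  next
    case 2
    then have "w (k + 1) < w k" using D(2)[of k "k + 1"] by auto
    then show thesis
      using signed_inv_adj_swap[OF 2(1,2), of w] 2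
      by (intro that[of "adj_swap k"]) (auto simp only: fundamental_reflections_eq, simp_all)
  qed
qed

text \<open>The upper bound on Coxeter length: strip off a descent \<open>s\<close>, take a word for
  \<open>w \<circ> s\<close> by induction, and append \<open>s\<close>, which cancels because
  \<open>s\<close> is an involution.\<close>

lemma reduced_word_exists:
  assumes "w \<in> signed_perms n"
  shows "\<exists>ss. length ss = signed_inv {1..int n} w \<and> set ss \<subseteq> fundamental_reflections n \<and>
    foldr (\<circ>) ss id = w"
  using assms
proof (induction "signed_inv {1..int n} w" arbitrary: w rule: less_induct)
  case less
  show ?case
  proof (cases "w = id")
    case True
    then show ?thesis by (intro exI[of _ "[]"]) (simp add: signed_inv_id)
  next
    case False
    from exists_descent[OF less.prems False] obtain s where s: "s \<in> fundamental_reflections n"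
      "Suc (signed_inv {1..int n} (w \<circ> s)) = signed_inv {1..int n} w" by blast
    have "w \<circ> s \<in> signed_perms n"
      using s(1) fundamental_reflections_signed_perms signed_perms_comp less.prems by blast
    moreover have "signed_inv {1..int n} (w \<circ> s) < signed_inv {1..int n} w" using s(2) by linarith
    ultimately obtain ss where ss:
      "length ss = signed_inv {1..int n} (w \<circ> s)" "set ss \<subseteq> fundamental_reflections n"
      "foldr (\<circ>) ss id = w \<circ> s" using less.hyps by blast
    have "s \<circ> s = id"
      using s(1) adj_swap_involution by (auto simp: fundamental_reflections_eq fun_eq_iff)
    then have "foldr (\<circ>) (ss @ [s]) id = w"
      unfolding foldr_comp_snoc ss(3) by (simp add: comp_assoc)
    moreover have "length (ss @ [s]) = signed_inv {1..int n} w" using ss(1) s(2) by simp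
    moreover have "set (ss @ [s]) \<subseteq> fundamental_reflections n" using ss(2) s(1) by simp
    ultimately show ?thesis by blast
  qed
qed

lemma coxeter_length_eq:
  assumes "w \<in> signed_perms n"
  shows "coxeter_length n w = signed_inv {1..int n} w"
  unfolding coxeter_length_def
proof (rule Least_equality)
  show "\<exists>ss. length ss = signed_inv {1..int n} w \<and> set ss \<subseteq> fundamental_reflections n \<and>
      foldr (\<circ>) ss id = w"
    by (rule reduced_word_exists[OF assms])
  fix k assume "\<exists>ss. length ss = k \<and> set ss \<subseteq> fundamental_reflections n \<and> foldr (\<circ>) ss id = w"
  then obtain ss where ss: "length ss = k" "set ss \<subseteq> fundamental_reflections n"
    "foldr (\<circ>) ss id = w" by blast
  from signed_inv_foldr_le[OF ss(2)] show "signed_inv {1..int n} w \<le> k"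
    by (simp only: ss(1,3))
qed

section \<open>The generating function of involutions\<close>

text \<open>Bijectivity comes with \<open>w \<circ> w = id\<close>, leaving oddness and the support
  to be stated.\<close>

definition signed_involutions :: "int set \<Rightarrow> (int \<Rightarrow> int) set" where
  "signed_involutions A =
     {w. w \<circ> w = id \<and> (\<forall>i. w (- i) = - w i) \<and> (\<forall>i. \<bar>i\<bar> \<notin> A \<longrightarrow> w i = i)}"

lemma signed_involutionsD:
  assumes "w \<in> signed_involutions A"
  shows "w (w i) = i" "w (- i) = - w i" "\<bar>i\<bar> \<notin> A \<Longrightarrow> w i = i" "w 0 = 0"
    "w i = w j \<longleftrightarrow> i = j"
proof -
  show inv: "w (w i) = i" for i using assms by (auto simp: signed_involutions_def fun_eq_iff)
  show odd: "w (- i) = - w i" for i using assms by (auto simp: signed_involutions_def)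
  show "\<bar>i\<bar> \<notin> A \<Longrightarrow> w i = i" using assms by (auto simp: signed_involutions_def)
  show "w 0 = 0" using odd[of 0] by simp
  show "w i = w j \<longleftrightarrow> i = j" using inv by metis
qed

lemma signed_involutions_abs_in:
  assumes "w \<in> signed_involutions A" "\<bar>i\<bar> \<in> A"
  shows "\<bar>w i\<bar> \<in> A"
  using signed_involutionsD[OF assms(1)] assms(2) by metis

text \<open>Forgetting signs turns \<open>w\<close> into an ordinary involution of the nonnegative
  integers.\<close>

lemma signed_involutions_abs_abs:
  assumes "w \<in> signed_involutions A"
  shows "\<bar>w \<bar>w i\<bar>\<bar> = \<bar>i\<bar>"
  using signed_involutionsD(1,2)[OF assms] by (metis abs_if abs_minus_cancel)

lemma finite_signed_involutions:
  assumes "finite A"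
  shows "finite (signed_involutions A)"
proof (rule finite_subset)
  show "signed_involutions A \<subseteq> {w. w permutes (A \<union> uminus ` A)}"
  proof
    fix w assume "w \<in> signed_involutions A"
    note D = signed_involutionsD[OF this]
    have "w permutes (A \<union> uminus ` A)"
    proof (rule involution_permutes)
      show "w i = i" if "i \<notin> A \<union> uminus ` A" for i
      proof (rule D(3))
        have "i = \<bar>i\<bar> \<or> i = - \<bar>i\<bar>" by arith
        then show "\<bar>i\<bar> \<notin> A" using that by (metis UnCI imageI)
      qed
    qed (rule D(1))
    then show "w \<in> {w. w permutes (A \<union> uminus ` A)}" by simp
  qed
qed (simp add: assms finite_permutations)

lemma signed_perms_involutions:
  "{w \<in> signed_perms n. w \<circ> w = id} = signed_involutions {1..int n}"
proof (intro set_eqI iffI)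
  fix w assume "w \<in> {w \<in> signed_perms n. w \<circ> w = id}"
  then have w: "w \<in> signed_perms n" "w \<circ> w = id" by auto
  have "w i = i" if "\<bar>i\<bar> \<notin> {1..int n}" for i
  proof -
    from that have "i = 0 \<or> i \<notin> {- int n..int n}" by auto
    then show ?thesis
      using signed_permsD(3)[OF w(1), of i] signed_permsD(4)[OF w(1)] by (elim disjE) simp_all
  qed
  then show "w \<in> signed_involutions {1..int n}"
    using w(2) signed_permsD(1)[OF w(1)] unfolding signed_involutions_def by simp
next
  fix w assume w: "w \<in> signed_involutions {1..int n}"
  note D = signed_involutionsD[OF w]
  have "w permutes ({- int n..int n} - {0})"
  proof (rule involution_permutes)
    show "w i = i" if "i \<notin> {- int n..int n} - {0}" for i
      by (rule D(3)) (use that in auto)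
  qed (rule D(1))
  then show "w \<in> {w \<in> signed_perms n. w \<circ> w = id}"
    using D(1,2) by (simp add: signed_perms_def fun_eq_iff)
qed

definition involution_gf :: "int set \<Rightarrow> nat poly" where
  "involution_gf A = (\<Sum>w\<in>signed_involutions A. monom 1 (signed_inv A w))"

lemma involution_count_eq_coeff: "involution_count n l = coeff (involution_gf {1..int n}) l"
proof -
  have "{x \<in> signed_perms n. x \<circ> x = id \<and> coxeter_length n x = l} =
      {w \<in> signed_involutions {1..int n}. signed_inv {1..int n} w = l}"
    unfolding signed_perms_involutions[symmetric] by (auto simp: coxeter_length_eq)
  then have "involution_count n l =
      (\<Sum>w\<in>{w \<in> signed_involutions {1..int n}. signed_inv {1..int n} w = l}. 1)"
    by (simp add: involution_count_def)
  also have "\<dots> = (\<Sum>w\<in>signed_involutions {1..int n}.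
      if signed_inv {1..int n} w = l then 1 else 0)"
    by (intro sum.inter_filter finite_signed_involutions) simp
  also have "\<dots> = coeff (involution_gf {1..int n}) l"
    by (simp add: involution_gf_def coeff_sum del: One_nat_def)
  finally show ?thesis .
qed

section \<open>Deleting and restoring the orbit of one element\<close>

text \<open>Restores the deleted orbit of \<open>n\<close>: from \<open>n\<close> going to
  \<open>e\<close>, oddness and involutivity force \<open>\<bar>e\<bar>\<close> to go to
  \<open>sgn e * n\<close>. If \<open>\<bar>e\<bar> = n\<close>, the first branch alone describes
  the orbit.\<close>

definition glue :: "int \<Rightarrow> int \<Rightarrow> (int \<Rightarrow> int) \<Rightarrow> int \<Rightarrow> int" where
  "glue n e v i =
     (if \<bar>i\<bar> = n then sgn i * e else if \<bar>i\<bar> = \<bar>e\<bar> then sgn i * sgn e * n else v i)"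

definition unglue :: "int \<Rightarrow> int \<Rightarrow> (int \<Rightarrow> int) \<Rightarrow> int \<Rightarrow> int" where
  "unglue n e w i = (if \<bar>i\<bar> \<in> {n, \<bar>e\<bar>} then i else w i)"

text \<open>Up to sign \<open>w\<close> exchanges \<open>n\<close> and \<open>\<bar>e\<bar>\<close>,
  so it also preserves the complement of these two.\<close>

lemma signed_involutions_avoid:
  assumes "w \<in> signed_involutions A" "0 < n" "w n = e" "\<bar>i\<bar> \<notin> {n, \<bar>e\<bar>}"
  shows "\<bar>w i\<bar> \<notin> {n, \<bar>e\<bar>}"
proof -
  note abs = signed_involutions_abs_abs[OF assms(1)]
  have "\<bar>w \<bar>e\<bar>\<bar> = n" "\<bar>w n\<bar> = \<bar>e\<bar>" using abs[of n] assms(2,3) by auto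
  then show ?thesis using abs[of i] assms(4) by auto
qed

lemma unglue_signed_involutions:
  assumes "w \<in> signed_involutions A" "0 < n" "w n = e"
  shows "unglue n e w \<in> signed_involutions (A - {n, \<bar>e\<bar>})"
proof -
  note D = signed_involutionsD[OF assms(1)] and avoid = signed_involutions_avoid[OF assms]
  have "unglue n e w (unglue n e w i) = i" for i
    using avoid[of i] D(1) by (simp add: unglue_def)
  moreover have "unglue n e w (- i) = - unglue n e w i" for i
    using D(2) by (simp add: unglue_def)
  moreover have "unglue n e w i = i" if "\<bar>i\<bar> \<notin> A - {n, \<bar>e\<bar>}" for i
    using D(3)[of i] that by (auto simp: unglue_def)
  ultimately show ?thesis by (simp add: signed_involutions_def fun_eq_iff)
qed

lemma glue_signed_involutions:
  assumes v: "v \<in> signed_involutions (A - {n, \<bar>e\<bar>})" and "0 < n" "n \<in> A" "\<bar>e\<bar> \<in> A" "e \<noteq> 0"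
  shows "glue n e v \<in> signed_involutions A" "glue n e v n = e"
proof -
  note D = signed_involutionsD[OF v]
  have "\<bar>v i\<bar> \<notin> {n, \<bar>e\<bar>}" if "\<bar>i\<bar> \<notin> {n, \<bar>e\<bar>}" for i
    using signed_involutions_abs_in[OF v, of i] D(3)[of i] that by fastforce
  then have "glue n e v (glue n e v i) = i" for i
    using D(1) assms(2,5) by (auto simp: glue_def abs_mult sgn_mult sgn_if)
  moreover have "glue n e v (- i) = - glue n e v i" for i
    using D(2) by (simp add: glue_def)
  moreover have "glue n e v i = i" if "\<bar>i\<bar> \<notin> A" for i
    using D(3)[of i] that assms(3,4) by (auto simp: glue_def)
  ultimately show "glue n e v \<in> signed_involutions A"
    by (simp add: signed_involutions_def fun_eq_iff)
  show "glue n e v n = e" using assms(2) by (simp add: glue_def)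
qed

lemma unglue_glue:
  assumes "v \<in> signed_involutions (A - {n, \<bar>e\<bar>})"
  shows "unglue n e (glue n e v) = v"
proof
  fix i show "unglue n e (glue n e v) i = v i"
    using signed_involutionsD(3)[OF assms, of i] by (auto simp: unglue_def glue_def)
qed

lemma glue_unglue:
  assumes "w \<in> signed_involutions A" "0 < n" "w n = e" "e \<noteq> 0"
  shows "glue n e (unglue n e w) = w"
proof
  note D = signed_involutionsD[OF assms(1)]
  have e: "w e = n" using D(1) assms(3) by metis
  have w: "w i = sgn i * w \<bar>i\<bar>" for i
    using D(2)[of i] D(4) by (auto simp: abs_if sgn_if)
  have "w \<bar>e\<bar> = sgn e * n"
    using D(2) e by (auto simp: abs_if sgn_if assms(4))
  then have "\<bar>i\<bar> = \<bar>e\<bar> \<Longrightarrow> w i = sgn i * sgn e * n" "\<bar>i\<bar> = n \<Longrightarrow> w i = sgn i * e" for i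
    using w[of i] assms(3) by simp_all
  then show "glue n e (unglue n e w) i = w i" for i
    by (simp add: unglue_def glue_def)
qed

text \<open>\<open>glue\<close> and \<open>unglue\<close> are inverse bijections between the fibre
  \<open>w n = e\<close> and the involutions on the smaller set. A drop \<open>d\<close> that is
  constant on the fibre factors out as a monomial.\<close>

lemma fiber_gf:
  assumes "A \<subseteq> {0<..}" "n \<in> A" "\<bar>e\<bar> \<in> A"
    and inv: "\<And>w. w \<in> signed_involutions A \<Longrightarrow> w n = e \<Longrightarrow>
      signed_inv A w = d + signed_inv (A - {n, \<bar>e\<bar>}) w"
  shows "(\<Sum>w\<in>{w \<in> signed_involutions A. w n = e}. monom 1 (signed_inv A w)) =
    monom 1 d * involution_gf (A - {n, \<bar>e\<bar>})"
  unfolding involution_gf_def sum_distrib_left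
proof (rule sum.reindex_bij_witness[of _ "glue n e" "unglue n e"])
  have n: "0 < n" "e \<noteq> 0" using assms(1-3) by auto
  fix w assume w: "w \<in> {w \<in> signed_involutions A. w n = e}"
  then show "glue n e (unglue n e w) = w" "unglue n e w \<in> signed_involutions (A - {n, \<bar>e\<bar>})"
    using n by (auto simp: glue_unglue unglue_signed_involutions)
  \<comment> \<open>The statistic sees only positions in the smaller set, where
    \<open>unglue\<close> changes nothing.\<close>
  have "signed_inv (A - {n, \<bar>e\<bar>}) (unglue n e w) = signed_inv (A - {n, \<bar>e\<bar>}) w"
  proof (rule signed_inv_cong)
    fix i assume i: "i \<in> A - {n, \<bar>e\<bar>}"
    with assms(1) have "\<bar>i\<bar> = i" by auto
    with i show "unglue n e w i = w i" by (simp add: unglue_def)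
  qed
  then show "monom 1 d * monom 1 (signed_inv (A - {n, \<bar>e\<bar>}) (unglue n e w)) =
      (monom 1 (signed_inv A w) :: nat poly)"
    using inv w by (simp add: mult_monom)
next
  have n: "0 < n" "e \<noteq> 0" using assms(1-3) by auto
  fix v assume "v \<in> signed_involutions (A - {n, \<bar>e\<bar>})"
  then show "unglue n e (glue n e v) = v" "glue n e v \<in> {w \<in> signed_involutions A. w n = e}"
    using n assms(2,3) by (simp_all add: unglue_glue glue_signed_involutions)
qed

section \<open>Loss of length when the maximum is deleted\<close>

context
  fixes A :: "int set" and n :: int
  assumes fin: "finite A" and pos: "A \<subseteq> {0<..}" and n_in: "n \<in> A"
    and n_max: "\<And>a. a \<in> A \<Longrightarrow> a \<le> n"
begin

lemma n_pos: "0 < n"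
  using pos n_in by auto

text \<open>The remaining positions are stable under \<open>w\<close> up to sign and lie below the
  maximum \<open>n\<close>, hence so do the absolute values of their images.\<close>

lemma abs_image_bounds:
  assumes "w \<in> signed_involutions A" "c \<in> A - {n, \<bar>w n\<bar>}"
  shows "\<bar>w c\<bar> \<in> A - {n, \<bar>w n\<bar>}" "\<bar>w c\<bar> < n" "c < n" "0 < c"
proof -
  have c: "0 < c" "c \<in> A" using assms(2) pos by auto
  show "0 < c" by (fact c)
  have "\<bar>w c\<bar> \<in> A" using signed_involutions_abs_in[OF assms(1), of c] c by simp
  moreover have "\<bar>w c\<bar> \<notin> {n, \<bar>w n\<bar>}"
    by (rule signed_involutions_avoid[OF assms(1) n_pos refl]) (use assms(2) c in auto)
  ultimately show "\<bar>w c\<bar> \<in> A - {n, \<bar>w n\<bar>}" "\<bar>w c\<bar> < n"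
    using n_max[of "\<bar>w c\<bar>"] by auto
  show "c < n" using n_max[of c] assms(2) by auto
qed

text \<open>\<open>c \<mapsto> \<bar>w c\<bar>\<close> permutes the remaining positions. This is why
  the loss of length depends on \<open>w n\<close> only and not on the rest of
  \<open>w\<close>.\<close>

lemma sum_abs_image:
  assumes "w \<in> signed_involutions A"
  shows "(\<Sum>c\<in>A - {n, \<bar>w n\<bar>}. f \<bar>w c\<bar>) = (\<Sum>c\<in>A - {n, \<bar>w n\<bar>}. f c)"
proof (rule sum.reindex_bij_witness[of _ "\<lambda>c. \<bar>w c\<bar>" "\<lambda>c. \<bar>w c\<bar>"])
  fix c assume c: "c \<in> A - {n, \<bar>w n\<bar>}"
  show "\<bar>w \<bar>w c\<bar>\<bar> = c"
    using signed_involutions_abs_abs[OF assms, of c] abs_image_bounds(4)[OF assms c] by simp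
  then show "\<bar>w \<bar>w c\<bar>\<bar> = c" .
  show "\<bar>w c\<bar> \<in> A - {n, \<bar>w n\<bar>}" by (rule abs_image_bounds(1)[OF assms c])
  then show "\<bar>w c\<bar> \<in> A - {n, \<bar>w n\<bar>}" .
qed (rule refl)

text \<open>All other values lie strictly between \<open>- n\<close> and \<open>n\<close>, so no
  pair involving \<open>n\<close> is inverted.\<close>

lemma signed_inv_max_fixed:
  assumes w: "w \<in> signed_involutions A" and "w n = n"
  shows "signed_inv A w = signed_inv (A - {n}) w"
proof -
  have A: "A = insert n (A - {n})" using n_in by auto
  have "(\<Sum>c\<in>A - {n}. if c < n then pair_inv (w c) (w n) else pair_inv (w n) (w c)) = 0"
  proof (intro sum.neutral ballI)
    fix c assume "c \<in> A - {n}"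
    then have c: "c \<in> A - {n, \<bar>w n\<bar>}" using assms(2) n_pos by simp
    have "- n < w c" "w c < n" using abs_image_bounds(2)[OF w c] by auto
    then show "(if c < n then pair_inv (w c) (w n) else pair_inv (w n) (w c)) = 0"
      using abs_image_bounds(3)[OF w c] by (simp add: pair_inv_def assms(2))
  qed
  then show ?thesis
    using fin n_pos assms(2) by (subst A, subst signed_inv_insert) auto
qed

text \<open>By the same bounds both conditions of \<open>pair_inv\<close> hold for every pair
  involving \<open>n\<close>; the extra 1 is the root \<open>e_n\<close>.\<close>

lemma signed_inv_max_negated:
  assumes w: "w \<in> signed_involutions A" and "w n = - n"
  shows "signed_inv A w = 2 * card (A - {n}) + 1 + signed_inv (A - {n}) w"
proof -
  have A: "A = insert n (A - {n})" using n_in by auto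
  have "(\<Sum>c\<in>A - {n}. if c < n then pair_inv (w c) (w n) else pair_inv (w n) (w c)) =
      (\<Sum>c\<in>A - {n}. 2)"
  proof (rule sum.cong[OF refl])
    fix c assume "c \<in> A - {n}"
    then have c: "c \<in> A - {n, \<bar>w n\<bar>}" using assms(2) n_pos by simp
    have "- n < w c" "w c < n" using abs_image_bounds(2)[OF w c] by auto
    then show "(if c < n then pair_inv (w c) (w n) else pair_inv (w n) (w c)) = 2"
      using abs_image_bounds(3)[OF w c] by (simp add: pair_inv_def assms(2))
  qed
  then show ?thesis
    using fin n_pos assms(2) by (subst A, subst signed_inv_insert) auto
qed

text \<open>Common start of the next two cases: peel off \<open>n\<close>, then \<open>m\<close>.
  The maximum always comes second in its pairs, whereas \<open>c\<close> may stand on either side of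
  \<open>m\<close>.\<close>

lemma signed_inv_max_moved:
  assumes w: "w \<in> signed_involutions A" and m: "\<bar>w n\<bar> = m" "m \<noteq> n"
  shows "signed_inv A w = signed_inv (A - {n, m}) w + pair_inv (w m) (w n) +
    of_bool (w m < 0) + of_bool (w n < 0) +
    (\<Sum>c\<in>A - {n, m}. (if c < m then pair_inv (w c) (w m) else pair_inv (w m) (w c)) +
      pair_inv (w c) (w n))"
proof -
  let ?C = "A - {n, m}"
  have mA: "m \<in> A" using signed_involutions_abs_in[OF w, of n] m n_in n_pos by auto
  have mn: "m < n" using n_max[OF mA] m by simp
  have A: "A = insert n (insert m ?C)" using n_in mA by auto
  have "(\<Sum>c\<in>insert m ?C. if c < n then pair_inv (w c) (w n) else pair_inv (w n) (w c)) =
      (\<Sum>c\<in>insert m ?C. pair_inv (w c) (w n))"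
    using abs_image_bounds(3)[OF w] mn m by (intro sum.cong) auto
  also have "\<dots> = pair_inv (w m) (w n) + (\<Sum>c\<in>?C. pair_inv (w c) (w n))"
    using fin by simp
  finally show ?thesis
    using fin m(2) by (subst A, subst signed_inv_insert) (auto simp: signed_inv_insert sum.distrib)
qed

text \<open>A remaining \<open>c\<close> is inverted with position \<open>m\<close> iff
  \<open>m < c\<close>, and contributes with position \<open>n\<close> iff
  \<open>m < \<bar>w c\<bar>\<close>. By \<open>sum_abs_image\<close> the two counts agree. The
  extra 1 is the pair \<open>(m, n)\<close> itself.\<close>

lemma signed_inv_max_swapped:
  assumes w: "w \<in> signed_involutions A" and m: "w n = m" "0 < m" "m \<noteq> n"
  shows "signed_inv A w =
    2 * (\<Sum>c\<in>A - {n, m}. of_bool (m < c)) + 1 + signed_inv (A - {n, m}) w"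
proof -
  let ?C = "A - {n, m}"
  have wm: "w m = n" using signed_involutionsD(1)[OF w] m by metis
  have mn: "m < n"
    using n_max[of m] signed_involutions_abs_in[OF w, of n] m n_in n_pos by auto
  have abs: "\<bar>w n\<bar> = m" using m by simp
  have "(\<Sum>c\<in>?C. (if c < m then pair_inv (w c) (w m) else pair_inv (w m) (w c)) +
      pair_inv (w c) (w n)) = (\<Sum>c\<in>?C. of_bool (m < c) + of_bool (m < \<bar>w c\<bar>))"
  proof (rule sum.cong[OF refl])
    fix c assume "c \<in> ?C"
    then have c: "c \<in> A - {n, \<bar>w n\<bar>}" "c \<noteq> m" using abs by simp_all
    have "- n < w c" "w c < n" using abs_image_bounds(2)[OF w c(1)] by auto
    then show "(if c < m then pair_inv (w c) (w m) else pair_inv (w m) (w c)) +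
        pair_inv (w c) (w n) = of_bool (m < c) + of_bool (m < \<bar>w c\<bar>)"
      unfolding wm m(1) pair_inv_def using m(2) c(2) by (auto simp: of_bool_def)
  qed
  also have "\<dots> = 2 * (\<Sum>c\<in>?C. of_bool (m < c))"
    using sum_abs_image[OF w, of "\<lambda>x. of_bool (m < x) :: nat"] by (simp add: sum.distrib abs)
  finally show ?thesis
    using mn m(2) by (subst signed_inv_max_moved[OF w abs m(3)]) (simp add: wm m(1) pair_inv_def)
qed

text \<open>Each \<open>c\<close> contributes at least 1 with \<open>m\<close> and with
  \<open>n\<close>, plus 1 when \<open>c < m\<close> and plus 1 when
  \<open>\<bar>w c\<bar> < m\<close>; these last counts agree by \<open>sum_abs_image\<close>. The 3
  consists of two negative values and one inversion in the pair \<open>(m, n)\<close>.\<close>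

lemma signed_inv_max_swapped_negated:
  assumes w: "w \<in> signed_involutions A" and m: "w n = - m" "0 < m" "m \<noteq> n"
  shows "signed_inv A w =
    2 * card (A - {n, m}) + 2 * (\<Sum>c\<in>A - {n, m}. of_bool (c < m)) + 3 +
    signed_inv (A - {n, m}) w"
proof -
  let ?C = "A - {n, m}"
  have wm: "w m = - n"
    using signed_involutionsD(1)[OF w, of n] signed_involutionsD(2)[OF w, of m] m by simp
  have mn: "m < n"
    using n_max[of m] signed_involutions_abs_in[OF w, of n] m n_in n_pos by auto
  have abs: "\<bar>w n\<bar> = m" using m by simp
  have "(\<Sum>c\<in>?C. (if c < m then pair_inv (w c) (w m) else pair_inv (w m) (w c)) +
      pair_inv (w c) (w n)) = (\<Sum>c\<in>?C. 2 + of_bool (c < m) + of_bool (\<bar>w c\<bar> < m))"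
  proof (rule sum.cong[OF refl])
    fix c assume "c \<in> ?C"
    then have c: "c \<in> A - {n, \<bar>w n\<bar>}" "c \<noteq> m" using abs by simp_all
    have "\<bar>w c\<bar> \<noteq> m" "- n < w c" "w c < n"
      using abs_image_bounds(1,2)[OF w c(1)] abs by auto
    then show "(if c < m then pair_inv (w c) (w m) else pair_inv (w m) (w c)) +
        pair_inv (w c) (w n) = 2 + of_bool (c < m) + of_bool (\<bar>w c\<bar> < m)"
      unfolding wm m(1) pair_inv_def using m(2) c(2) by (auto simp: of_bool_def)
  qed
  also have "\<dots> = 2 * card ?C + 2 * (\<Sum>c\<in>?C. of_bool (c < m))"
    unfolding sum.distrib
    using sum_abs_image[OF w, of "\<lambda>x. of_bool (x < m) :: nat"] by (simp add: abs)
  finally show ?thesis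
    using mn m(2) by (subst signed_inv_max_moved[OF w abs m(3)]) (simp add: wm m(1) pair_inv_def)
qed

text \<open>Sort the involutions by \<open>w n\<close>, which lies in \<open>A\<close> or in
  \<open>- A\<close>, and apply \<open>fiber_gf\<close> to each fibre. The values \<open>n\<close>
  and \<open>- n\<close> give the first product, each pair \<open>m\<close>, \<open>- m\<close> one
  summand.\<close>

lemma involution_gf_rec:
  "involution_gf A = (1 + monom 1 (2 * card (A - {n}) + 1)) * involution_gf (A - {n}) +
    (\<Sum>m\<in>A - {n}. (monom 1 (2 * (\<Sum>c\<in>A - {n, m}. of_bool (m < c)) + 1) +
        monom 1 (2 * card (A - {n, m}) + 2 * (\<Sum>c\<in>A - {n, m}. of_bool (c < m)) + 3)) *
      involution_gf (A - {n, m}))"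
proof -
  \<comment> \<open>\<open>f e\<close> is the contribution of the fibre
    \<open>w n = e\<close>.\<close>
  define f where
    "f e = (\<Sum>w\<in>{w \<in> signed_involutions A. w n = e}. monom (1 :: nat) (signed_inv A w))" for e
  have "w n \<in> A \<union> uminus ` A" if "w \<in> signed_involutions A" for w
  proof -
    have "\<bar>w n\<bar> \<in> A" using signed_involutions_abs_in[OF that, of n] n_in n_pos by simp
    moreover have "w n = \<bar>w n\<bar> \<or> w n = - \<bar>w n\<bar>" by arith
    ultimately show ?thesis by (metis UnCI imageI)
  qed
  then have "involution_gf A = (\<Sum>e\<in>A \<union> uminus ` A. f e)"
    unfolding f_def involution_gf_def
    using fin by (intro sum.group[symmetric] finite_signed_involutions) auto
  also have "\<dots> = (\<Sum>e\<in>A. f e) + (\<Sum>e\<in>uminus ` A. f e)"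
  proof (intro sum.union_disjoint)
    show "A \<inter> uminus ` A = {}"
    proof (rule equals0I)
      fix x assume "x \<in> A \<inter> uminus ` A"
      then obtain y where "x \<in> A" "y \<in> A" "x = - y" by blast
      with pos have "0 < x" "0 < y" by auto
      with \<open>x = - y\<close> show False by simp
    qed
  qed (use fin in simp_all)
  also have "\<dots> = (\<Sum>e\<in>A. f e + f (- e))"
    by (simp add: sum.reindex sum.distrib)
  also have "\<dots> = f n + f (- n) + (\<Sum>m\<in>A - {n}. f m + f (- m))"
    using fin n_in by (rule sum.remove)
  also have "f n = involution_gf (A - {n})"
    unfolding f_def using fiber_gf[of A n n 0] n_pos pos n_in
    by (simp add: signed_inv_max_fixed del: One_nat_def)
  also have "f (- n) = monom 1 (2 * card (A - {n}) + 1) * involution_gf (A - {n})"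
    unfolding f_def
    using fiber_gf[of A n "- n" "2 * card (A - {n}) + 1"] n_pos pos n_in
    by (simp add: signed_inv_max_negated)
  also have "(\<Sum>m\<in>A - {n}. f m + f (- m)) =
    (\<Sum>m\<in>A - {n}. (monom 1 (2 * (\<Sum>c\<in>A - {n, m}. of_bool (m < c)) + 1) +
        monom 1 (2 * card (A - {n, m}) + 2 * (\<Sum>c\<in>A - {n, m}. of_bool (c < m)) + 3)) *
      involution_gf (A - {n, m}))"
  proof (rule sum.cong[OF refl])
    fix m assume "m \<in> A - {n}"
    then have m: "0 < m" "m \<in> A" "m \<noteq> n" using pos by auto
    have "f m = monom 1 (2 * (\<Sum>c\<in>A - {n, m}. of_bool (m < c)) + 1) *
        involution_gf (A - {n, m})"
      unfolding f_def
      using fiber_gf[OF pos n_in, of m "2 * (\<Sum>c\<in>A - {n, m}. of_bool (m < c)) + 1"] m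
      by (simp add: signed_inv_max_swapped)
    moreover have "f (- m) = monom 1 (2 * card (A - {n, m}) +
        2 * (\<Sum>c\<in>A - {n, m}. of_bool (c < m)) + 3) * involution_gf (A - {n, m})"
      unfolding f_def
      using fiber_gf[OF pos n_in, of "- m" "2 * card (A - {n, m}) +
        2 * (\<Sum>c\<in>A - {n, m}. of_bool (c < m)) + 3"] m
      by (simp add: signed_inv_max_swapped_negated)
    ultimately show "f m + f (- m) = (monom 1 (2 * (\<Sum>c\<in>A - {n, m}. of_bool (m < c)) + 1) +
        monom 1 (2 * card (A - {n, m}) + 2 * (\<Sum>c\<in>A - {n, m}. of_bool (c < m)) + 3)) *
      involution_gf (A - {n, m})"
      by (simp only: distrib_right)
  qed
  finally show ?thesis by (simp add: distrib_right)
qed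

end

section \<open>A recursion in the cardinality alone\<close>

text \<open>Ranks run through \<open>0, ..., card B - 1\<close> once each: a new maximum leaves the
  old ranks unchanged and has the old cardinality as its rank.\<close>

lemma sum_by_rank:
  fixes B :: "'a::linorder set"
  assumes "finite B"
  shows "(\<Sum>m\<in>B. f (card {b \<in> B. b < m})) = (\<Sum>k<card B. f k)"
  using assms
proof (induction B rule: finite_linorder_max_induct)
  case empty
  show ?case by simp
next
  case (insert b B)
  have "{a \<in> insert b B. a < m} = {a \<in> B. a < m}" if "m \<in> B" for m
    using insert.hyps that by auto
  moreover have "{a \<in> insert b B. a < b} = B" using insert.hyps by auto
  moreover have "b \<notin> B" using insert.hyps by auto
  ultimately show ?case using insert by (simp add: add.commute)
qed

text \<open>The recursion for \<open>F n\<close> with \<open>n = Suc M\<close>. At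
  \<open>M = 0\<close> the truncated index \<open>M - 1\<close> is harmless, since the sum before it
  is empty.\<close>

fun involution_poly :: "nat \<Rightarrow> nat poly" where
  "involution_poly 0 = 1"
| "involution_poly (Suc M) = (1 + monom 1 (2 * M + 1)) * involution_poly M +
     (\<Sum>j<2 * M. monom 1 (2 * j + 1)) * involution_poly (M - 1)"

text \<open>The first family gives the odd exponents below \<open>2 * M\<close> in descending order,
  the second those between \<open>2 * M\<close> and \<open>4 * M\<close>.\<close>

lemma sum_odd_monom_split:
  "(\<Sum>k<M. monom 1 (2 * (M - Suc k) + 1) + monom 1 (2 * (M + k) + 1)) =
    (\<Sum>j<2 * M. monom (1 :: nat) (2 * j + 1))"
proof -
  let ?g = "\<lambda>j. monom (1 :: nat) (2 * j + 1)"
  have "(\<Sum>j<M + K. ?g j) = (\<Sum>j<M. ?g j) + (\<Sum>j<K. ?g (M + j))" for K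
    by (induction K) (simp_all add: add.assoc)
  from this[of M] show ?thesis
    by (simp only: sum.distrib sum.nat_diff_reindex[where g = ?g] mult_2[of M])
qed

text \<open>Strong induction, as the recursion reaches sets with one and with two elements fewer.
  Its exponents involve \<open>m\<close> only through its rank in \<open>A - {n}\<close>.\<close>

lemma involution_gf_eq:
  assumes "finite A" "A \<subseteq> {0<..}"
  shows "involution_gf A = involution_poly (card A)"
  using assms
proof (induction "card A" arbitrary: A rule: less_induct)
  case less
  show ?case
  proof (cases "A = {}")
    case True
    have "signed_involutions {} = {id}"
      by (simp add: signed_involutions_def fun_eq_iff set_eq_iff) (auto simp: fun_eq_iff)
    then show ?thesis
      using True by (simp add: involution_gf_def signed_inv_def ordered_pairs_def del: One_nat_def)
  next
    case False
    define n B M where "n = Max A" and "B = A - {n}" and "M = card B"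
    have n: "n \<in> A" "\<And>a. a \<in> A \<Longrightarrow> a \<le> n" using False less.prems by (auto simp: n_def)
    have B: "finite B" "B \<subseteq> {0<..}" using less.prems by (auto simp: B_def)
    have card: "card A = Suc M"
      unfolding M_def B_def by (rule card.remove) (use n less.prems in auto)
    have "(\<Sum>m\<in>B. (monom 1 (2 * (\<Sum>c\<in>A - {n, m}. of_bool (m < c)) + 1) +
        monom 1 (2 * card (A - {n, m}) + 2 * (\<Sum>c\<in>A - {n, m}. of_bool (c < m)) + 3)) *
        involution_gf (A - {n, m})) =
      (\<Sum>m\<in>B. (monom 1 (2 * (M - Suc (card {b \<in> B. b < m})) + 1) +
        monom 1 (2 * (M + card {b \<in> B. b < m}) + 1)) * involution_poly (M - 1))"
    proof (rule sum.cong[OF refl])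
      fix m assume m: "m \<in> B"
      let ?k = "card {b \<in> B. b < m}"
      have C: "A - {n, m} = B - {m}" by (auto simp: B_def)
      have cC: "card (B - {m}) = M - 1" using m B by (simp add: M_def)
      \<comment> \<open>Keeps \<open>M - 1\<close> from truncating when the exponents are compared
        below.\<close>
      have "M > 0" using m B by (auto simp: M_def card_gt_0_iff)
      have "{c \<in> B - {m}. c < m} = {b \<in> B. b < m}" by auto
      then have lower: "(\<Sum>c\<in>B - {m}. of_bool (c < m)) = ?k"
        using B by (simp add: Int_def flip: sum.inter_filter)
      have "(\<Sum>c\<in>B - {m}. of_bool (m < c) + of_bool (c < m)) = (\<Sum>c\<in>B - {m}. 1 :: nat)"
        by (intro sum.cong) auto
      \<comment> \<open>Every other element of \<open>B\<close> lies either above or below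
        \<open>m\<close>.\<close>
      then have "(\<Sum>c\<in>B - {m}. of_bool (m < c)) + ?k = M - 1"
        using cC lower by (simp add: sum.distrib)
      then have upper: "(\<Sum>c\<in>B - {m}. of_bool (m < c)) = M - Suc ?k"
        by linarith
      have "involution_gf (B - {m}) = involution_poly (M - 1)"
        unfolding cC[symmetric]
        by (rule less.hyps) (use cC card B in auto)
      moreover have "2 * (M - 1) + 2 * ?k + 3 = 2 * (M + ?k) + 1" using \<open>M > 0\<close> by simp
      ultimately show "(monom 1 (2 * (\<Sum>c\<in>A - {n, m}. of_bool (m < c)) + 1) +
          monom 1 (2 * card (A - {n, m}) + 2 * (\<Sum>c\<in>A - {n, m}. of_bool (c < m)) + 3)) *
          involution_gf (A - {n, m}) =
        (monom 1 (2 * (M - Suc ?k) + 1) + monom 1 (2 * (M + ?k) + 1)) * involution_poly (M - 1)"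
        unfolding C lower upper cC by (simp only:)
    qed
    also have "\<dots> = (\<Sum>j<2 * M. monom 1 (2 * j + 1)) * involution_poly (M - 1)"
      unfolding sum_distrib_right[symmetric]
      by (subst sum_by_rank[OF B(1),
          of "\<lambda>k. monom 1 (2 * (M - Suc k) + 1) + monom 1 (2 * (M + k) + 1)"])
        (simp only: M_def[symmetric] sum_odd_monom_split)
    finally have "involution_gf A = (1 + monom 1 (2 * M + 1)) * involution_gf B +
        (\<Sum>j<2 * M. monom 1 (2 * j + 1)) * involution_poly (M - 1)"
      using involution_gf_rec[OF less.prems n] by (simp only: B_def[symmetric] M_def[symmetric])
    moreover have "involution_gf B = involution_poly M"
      unfolding M_def by (rule less.hyps) (use B card M_def in auto)
    ultimately show ?thesis by (simp only: card involution_poly.simps)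
  qed
qed

lemma involution_count_eq: "involution_count n l = coeff (involution_poly n) l"
  by (subst involution_count_eq_coeff, subst involution_gf_eq) auto

section \<open>Evaluation for \<open>n = 6\<close>\<close>

text \<open>Lets the simplifier expand monomials into coefficient lists.\<close>

lemma monom_numeral: "monom c (numeral k) = pCons 0 (monom c (pred_numeral k))"
  by (simp add: numeral_eq_Suc monom_Suc)

text \<open>Each polynomial comes from a single use of the recursion on the two preceding
  coefficient lists. The degree 36 is the number of positive roots of \<open>B_6\<close>.\<close>

lemma involution_poly_6:
  "involution_poly 6 = [:1, 6, 10, 10, 20, 18, 27, 28, 35, 42, 41, 52, 49, 66, 51, 76, 55, 78, 54, 78,
      55, 76, 51, 66, 49, 52, 41, 42, 35, 28, 27, 18, 20, 10, 10, 6, 1:]"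
proof -
  have one: "monom (c :: nat) 1 = [:0, c:]" "{..<1} = {0 :: nat}" for c
    by (auto simp: monom_0 monom_Suc)
  note eval = one monom_numeral monom_0 monom_Suc one_pCons lessThan_nat_numeral
  have p0: "involution_poly 0 = [:1:]" by (simp add: one_pCons)
  have p1: "involution_poly 1 = [:1, 1:]" "involution_poly (Suc 0) = [:1, 1:]"
    using involution_poly.simps(2)[of 0] by (simp_all add: eval del: involution_poly.simps(2))
  have p2: "involution_poly 2 = [:1, 2, 0, 2, 1:]"
    using involution_poly.simps(2)[of 1]
    by (simp add: p1 p0 eval del: involution_poly.simps One_nat_def)
  have p3: "involution_poly 3 = [:1, 3, 1, 3, 2, 2, 3, 1, 3, 1:]"
    using involution_poly.simps(2)[of 2]
    by (simp add: p2 p1 eval del: involution_poly.simps One_nat_def)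
  have p4: "involution_poly 4 = [:1, 4, 3, 4, 6, 4, 7, 4, 10, 4, 7, 4, 6, 4, 3, 4, 1:]"
    using involution_poly.simps(2)[of 3]
    by (simp add: p3 p2 eval del: involution_poly.simps One_nat_def)
  have p5: "involution_poly 5 = [:1, 5, 6, 6, 12, 8, 15, 11, 19, 15, 21, 17, 20, 20, 17, 21, 15, 19, 11, 15, 8,
      12, 6, 6, 5, 1:]"
    using involution_poly.simps(2)[of 4]
    by (simp add: p4 p3 eval del: involution_poly.simps One_nat_def)
  show "involution_poly 6 = [:1, 6, 10, 10, 20, 18, 27, 28, 35, 42, 41, 52, 49, 66, 51, 76, 55, 78, 54, 78,
      55, 76, 51, 66, 49, 52, 41, 42, 35, 28, 27, 18, 20, 10, 10, 6, 1:]"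
    using involution_poly.simps(2)[of 5]
    by (simp add: p5 p4 eval del: involution_poly.simps One_nat_def)
qed

lemma involution_profile_6:
  "map (\<lambda>k. involution_count 6 (2 * k)) [0..<19] =
     [1, 10, 20, 27, 35, 41, 49, 51, 55, 54, 55, 51, 49, 41, 35, 27, 20, 10, 1]"
  by (simp add: involution_count_eq involution_poly_6 coeff_pCons' upt_rec
      del: involution_poly.simps)

text \<open>The coefficient at 36 is nonzero and all later ones vanish, so the last index is 18 and
  there are 19 entries.\<close>

lemma even_involution_profile_6:
  "even_involution_profile 6 = map (\<lambda>k. involution_count 6 (2 * k)) [0..<19]"
proof -
  have "involution_count 6 (2 * k) = 0" if "18 < k" for k
    unfolding involution_count_eq
    by (rule coeff_eq_0) (use that in \<open>simp add: involution_poly_6\<close>)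
  then have "k \<le> 18" if "involution_count 6 (2 * k) \<noteq> 0" for k
    using that by (meson not_le)
  moreover have "involution_count 6 (2 * 18) \<noteq> 0"
    by (simp add: involution_count_eq involution_poly_6 coeff_pCons')
  ultimately have "Max {k. involution_count 6 (2 * k) \<noteq> 0} = 18"
    by (intro Max_eqI) (auto intro: finite_subset[of _ "{..18}"])
  then show ?thesis by (simp add: even_involution_profile_def)
qed

text \<open>A peak at or after \<open>j\<close> forces a weak rise from \<open>i\<close> to
  \<open>j\<close>; a peak at or before \<open>j\<close> forces a weak fall from \<open>j\<close> to
  \<open>k\<close>. The dip at \<open>j\<close> contradicts both.\<close>

lemma not_unimodal_valley:
  assumes "i < j" "j < k" "k < length xs" "xs ! j < xs ! i" "xs ! j < xs ! k"
  shows "\<not> unimodal xs"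
proof
  assume "unimodal xs"
  then obtain p where p: "\<And>i. i < p \<Longrightarrow> xs ! i \<le> xs ! Suc i"
    "\<And>i. p \<le> i \<Longrightarrow> Suc i < length xs \<Longrightarrow> xs ! Suc i \<le> xs ! i"
    by (auto simp: unimodal_def)
  have "xs ! i \<le> xs ! j" if "j \<le> p"
    using \<open>i < j\<close> that by (induction rule: less_Suc_induct) (auto simp: p(1) Suc_le_eq)
  moreover have "xs ! k \<le> xs ! j" if "p \<le> j"
    using \<open>j < k\<close> \<open>k < length xs\<close> that by (induction rule: less_Suc_induct) (auto simp: p(2))
  ultimately show False using assms(4,5) by linarith
qed

theorem mainTheorem5:
  "map (\<lambda>k. involution_count 6 (2 * k)) [0..<19] =
     [1, 10, 20, 27, 35, 41, 49, 51, 55, 54, 55, 51, 49, 41, 35, 27, 20, 10, 1]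
   \<and> \<not> unimodal (map (\<lambda>k. involution_count 6 (2 * k)) [0..<19])
   \<and> \<not> (\<forall>n \<ge> 1. unimodal (even_involution_profile n))"
proof -
  have "\<not> unimodal (map (\<lambda>k. involution_count 6 (2 * k)) [0..<19])"
    \<comment> \<open>Indices 8, 9, 10 hold 55, 54, 55, the counts for lengths 16, 18, 20.\<close>
    unfolding involution_profile_6 by (rule not_unimodal_valley[of 8 9 10]) simp_all
  moreover from this have "\<not> unimodal (even_involution_profile 6)"
    by (simp only: even_involution_profile_6 not_False_eq_True)
  moreover have "(1 :: nat) \<le> 6" by simp
  ultimately show ?thesis using involution_profile_6 by blast
qed

end
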